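(* Consider a controlled Markov system with fixed cost functions $c_1,\dots,c_T$, and suppose a family of dynamic risk measures $\{\rho^\pi_{t,T}\}_{t=1,\dots,T}^{\pi\in\Pi}$ is normalized, translation-invariant, stochastically conditionally time-consistent, and Markov, with associated transition risk mappings $\sigma_t$, $t=1,\dots,T-1$. Equip $\mathcal{P}(\mathcal{X})$ with the topology of weak convergence. Assume the following conditions: (i) the transition kernels $Q_t(\cdot,\cdot)$, $t=1,\dots,T-1$, are weakly continuous; (ii) for every lower semicontinuous $v\in\mathcal{V}$ the transition risk mappings $\sigma_t(\cdot,\cdot,v)$, $t=1,\dots,T-1$, are lower semicontinuous; (iii) the functions $c_t(\cdot,\cdot)$, $t=1,\dots,T$, are lower semicontinuous; (iv) the multifunctions $\mathcal{U}_t(\cdot)$, $t=1,\dots,T$, are compact-valued and upper semicontinuous. Then the value functions $v^*_t$, $t=1,\dots,T$, are memoryless (i.e. $v^*_t(h_t)$ depends on $h_t=(x_1,\dots,x_t)$ only through $x_t$, so that one writes $v^*_t(x_t)$), lower semicontinuous, and satisfy the dynamic programming equations $$v^*_T(x)=\min_{u\in\mathcal{U}_T(x)}c_T(x,u),\quad x\in\mathcal{X},$$ $$v^*_t(x)=\min_{u\in\mathcal{U}_t(x)}\big\{c_t(x,u)+\sigma_t\big(x,Q_t(x,u),v^*_{t+1}\big)\big\},\quad x\in\mathcal{X},\ t=T-1,\dots,1.$$ Moreover, an optimal Markov policy $\hat\pi$ exists and satisfies $$\hat\pi_T(x)\in\operatorname*{argmin}_{u\in\mathcal{U}_T(x)}c_T(x,u),\quad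 x\in\mathcal{X},$$ $$\hat\pi_t(x)\in\operatorname*{argmin}_{u\in\mathcal{U}_t(x)}\big\{c_t(x,u)+\sigma_t\big(x,Q_t(x,u),v^*_{t+1}\big)\big\},\quad x\in\mathcal{X},\ t=T-1,\dots,1.$$
   Context: Setting. $\mathcal{X}$ is a Polish space with Borel $\sigma$-algebra, $T$ is a natural number, $X_1,\dots,X_T$ are the canonical projections on $\mathcal{X}^T$ (with product $\sigma$-algebra), $H_t=(X_1,\dots,X_t)$, $\mathcal{F}_t=\sigma(X_1,\dots,X_t)$, and $h_t=(x_1,\dots,x_t)\in\mathcal{X}^t$ denotes a history. $\mathcal{P}(\mathcal{X})$ is the set of probability measures on $\mathcal{X}$; $\mathcal{V}$ is the set of bounded measurable functions $\mathcal{X}\to\mathbb{R}$. $\mathcal{Z}_t$ is the set of bounded $\mathcal{F}_t$-measurable functions $\mathcal{X}^T\to\mathbb{R}$, identified with bounded measurable functions of $h_t\in\mathcal{X}^t$; $\mathcal{Z}_{t,T}=\mathcal{Z}_t\times\dots\times\mathcal{Z}_T$. Relations between random variables are understood everywhere. Controlled Markov system. $\mathcal{U}$ is a Borel control space; the admissible control sets are given by measurable multifunctions $\mathcal{U}_t:\mathcal{X}\rightrightarrows\mathcal{U}$, $t=1,\dots,T$; the transition kernels are measurable maps $Q_t:\operatorname{graph}(\mathcal{U}_t)\to\mathcal{P}(\mathcal{X})$, $t=1,\dots,T-1$ ($Q_t(x_t,u_t)$ is the conditional distribution of $X_{t+1}$); the costs are bounded measurable functions $c_t:\operatorname{graph}(\mathcal{U}_t)\to\mathbb{R}$,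 $t=1,\dots,T$. $\Pi$ is the set of (history-dependent) admissible policies $\pi=(\pi_1,\dots,\pi_T)$: each $\pi_t:\mathcal{X}^t\to\mathcal{U}$ is measurable with $\pi_t(x_1,\dots,x_t)\in\mathcal{U}_t(x_t)$. A policy is Markov if each $\pi_t$ depends only on $x_t$. For $\pi\in\Pi$, $Q^\pi_t(h_t)=Q_t(x_t,\pi_t(h_t))$. Dynamic risk measures. A conditional risk measure is a mapping $\rho_{t,T}:\mathcal{Z}_{t,T}\to\mathcal{Z}_t$ that is monotone: $Z_s\le W_s$ for $s=t,\dots,T$ implies $\rho_{t,T}(Z_t,\dots,Z_T)\le\rho_{t,T}(W_t,\dots,W_T)$. It is normalized if $\rho_{t,T}(0,\dots,0)=0$, and translation-invariant if $\rho_{t,T}(Z_t,\dots,Z_T)=Z_t+\rho_{t,T}(0,Z_{t+1},\dots,Z_T)$ always. A dynamic risk measure is a sequence $\{\rho_{t,T}\}_{t=1,\dots,T}$ of conditional risk measures; a family $\{\rho^\pi_{t,T}\}_{t=1,\dots,T}^{\pi\in\Pi}$ consists of one for each $\pi\in\Pi$, and has one of these properties if every $\rho^\pi_{t,T}$ has it. For bounded measurable $c=(c_1,\dots,c_T)$ and $\pi\in\Pi$, $$v^{c,\pi}_t(h_t)=\rho^\pi_{t,T}\big(c_t(X_t,\pi_t(H_t)),\dots,c_T(X_T,\pi_T(H_T))\big)(h_t).$$ Stochastic conditional time consistency. The family is stochastically conditionally time-consistent if for any $\pi,\pi'\in\Pi$, any $1\le t<T$, all $h_t\in\mathcal{X}^t$,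 and all $(Z_t,\dots,Z_T),(W_t,\dots,W_T)\in\mathcal{Z}_{t,T}$, the conditions $Z_t(h_t)=W_t(h_t)$ and $$Q^\pi_t(h_t)\big(\{x:\rho^\pi_{t+1,T}(Z_{t+1},\dots,Z_T)(h_t,x)>\eta\}\big)\le Q^{\pi'}_t(h_t)\big(\{x:\rho^{\pi'}_{t+1,T}(W_{t+1},\dots,W_T)(h_t,x)>\eta\}\big)\quad\forall\eta\in\mathbb{R}$$ imply $\rho^\pi_{t,T}(Z_t,\dots,Z_T)(h_t)\le\rho^{\pi'}_{t,T}(W_t,\dots,W_T)(h_t)$. Markov risk measures. The family is Markov if for all Markov policies $\pi\in\Pi$, all bounded measurable $c$, and all $h_t,h'_t\in\mathcal{X}^t$ with the same last component $x_t=x'_t$, one has $v^{c,\pi}_t(h_t)=v^{c,\pi}_t(h'_t)$. Transition risk mappings. For a translation-invariant, stochastically conditionally time-consistent, Markov family there exist functionals $\sigma_t:\{(x,Q_t(x,u)):x\in\mathcal{X},u\in\mathcal{U}_t(x)\}\times\mathcal{V}\to\mathbb{R}$, $t=1,\dots,T-1$ (the transition risk mappings), such that: $\sigma_t(x,q,0)=0$; for all $q^1,q^2\in\{Q_t(x,u):u\in\mathcal{U}_t(x)\}$ and $v^1,v^2\in\mathcal{V}$, if $q^1(\{v^1>\eta\})\le q^2(\{v^2>\eta\})$ for all $\eta\in\mathbb{R}$ then $\sigma_t(x,q^1,v^1)\le\sigma_t(x,q^2,v^2)$; and for all $\pi\in\Pi$, all bounded measurable $c$, and all $h_t\in\mathcal{X}^t$,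 $$v^{c,\pi}_t(h_t)=c_t(x_t,\pi_t(h_t))+\sigma_t\big(x_t,Q_t(x_t,\pi_t(h_t)),v^{c,\pi}_{t+1}(h_t,\cdot)\big).$$ Value functions. With $c$ fixed, write $v^\pi_t=v^{c,\pi}_t$; by the recursion above, $v^\pi_t(h_t)$ depends on $\pi$ only through $\pi_t,\dots,\pi_T$. The risk minimization problem is $\min_{\pi\in\Pi}v^\pi_1(x_1)$, $x_1\in\mathcal{X}$, and $$v^*_t(h_t)=\inf_{\pi\in\Pi_{t,T}(h_t)}v^\pi_t(h_t),\quad t=1,\dots,T,\ h_t\in\mathcal{X}^t,$$ where $\Pi_{t,T}(h_t)$ is the set of feasible deterministic (history-dependent) policies $\{\pi_t,\dots,\pi_T\}$ from history $h_t$ on. A policy $\hat\pi$ is optimal if $v_1^{\hat\pi}(x_1)=v_1^*(x_1)$ for all $x_1\in\mathcal{X}$. *)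

theory Defs
  imports "HOL-Probability.Probability"
begin

section \<open>Topological notions\<close>

text \<open>The topology of weak convergence on the Borel probability measures, i.e. the coarsest
  topology making \<open>M \<mapsto> \<integral>x. f x \<partial>M\<close> continuous for each bounded continuous \<open>f\<close>.  (\<open>weak_conv_m\<close> of
  the library is restricted to measures on the real line.)\<close>

definition weak_topology :: "'x::polish_space measure topology" where
  "weak_topology = topology_generated_by
     {{M \<in> space (prob_algebra borel). (\<integral>x. f x \<partial>M) \<in> A} | (f :: 'x \<Rightarrow> real) A.
        continuous_on UNIV f \<and> bounded (range f) \<and> open A}"

lemma topspace_weak_topology: "topspace weak_topology = space (prob_algebra borel)"
proof -
  let ?S = "{{M \<in> space (prob_algebra borel). (\<integral>x. f x \<partial>M) \<in> A} | (f :: 'a \<Rightarrow> real) A.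
        continuous_on UNIV f \<and> bounded (range f) \<and> open A}"
  have "space (prob_algebra borel) \<in> ?S"
    by (rule CollectI, rule exI[of _ "\<lambda>_. 0"], rule exI[of _ UNIV]) auto
  then have "\<Union>?S = space (prob_algebra borel)"
    by blast
  then show ?thesis
    unfolding weak_topology_def topology_generated_by_topspace .
qed

lemma limitin_weak_topology:
  fixes M :: "'x::polish_space measure"
  shows "limitin weak_topology N M F \<longleftrightarrow>
    M \<in> space (prob_algebra borel) \<and> (\<forall>\<^sub>F i in F. N i \<in> space (prob_algebra borel)) \<and>
    (\<forall>f :: 'x \<Rightarrow> real. continuous_on UNIV f \<longrightarrow> bounded (range f) \<longrightarrow>
       ((\<lambda>i. \<integral>x. f x \<partial>N i) \<longlongrightarrow> (\<integral>x. f x \<partial>M)) F)" (is "?L \<longleftrightarrow> ?R")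
proof
  assume L: ?L
  have M: "M \<in> space (prob_algebra borel)"
    using limitin_topspace[OF L] by (simp add: topspace_weak_topology)
  have ev: "\<forall>\<^sub>F i in F. N i \<in> space (prob_algebra borel)"
    using L unfolding limitin_def
    by (metis openin_topspace topspace_weak_topology)
  have "((\<lambda>i. \<integral>x. f x \<partial>N i) \<longlongrightarrow> (\<integral>x. f x \<partial>M)) F"
    if f: "continuous_on UNIV f" "bounded (range f)" for f :: "'x \<Rightarrow> real"
  proof (rule topological_tendstoI)
    fix A :: "real set" assume A: "open A" "(\<integral>x. f x \<partial>M) \<in> A"
    have "openin weak_topology {M \<in> space (prob_algebra borel). (\<integral>x. f x \<partial>M) \<in> A}"
      unfolding weak_topology_def by (rule topology_generated_by_Basis) (use f A in blast)
    moreover have "M \<in> {M \<in> space (prob_algebra borel). (\<integral>x. f x \<partial>M) \<in> A}"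
      using M A by simp
    ultimately have "\<forall>\<^sub>F i in F. N i \<in> {M \<in> space (prob_algebra borel). (\<integral>x. f x \<partial>M) \<in> A}"
      using L unfolding limitin_def by blast
    then show "\<forall>\<^sub>F i in F. (\<integral>x. f x \<partial>N i) \<in> A"
      by (rule eventually_mono) simp
  qed
  with M ev show ?R by blast
next
  assume R: ?R
  have "\<forall>\<^sub>F i in F. N i \<in> V" if "openin weak_topology V" "M \<in> V" for V
    using that unfolding weak_topology_def openin_topology_generated_by_iff
  proof induction
    case (Basis s)
    then obtain f A where fA: "continuous_on UNIV f" "bounded (range f)" "open A"
      "s = {M \<in> space (prob_algebra borel). (\<integral>x. (f :: 'x \<Rightarrow> real) x \<partial>M) \<in> A}" by blast
    then have "\<forall>\<^sub>F i in F. (\<integral>x. f x \<partial>N i) \<in> A"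
      using R Basis by (auto intro: topological_tendstoD)
    moreover have "\<forall>\<^sub>F i in F. N i \<in> space (prob_algebra borel)" using R by blast
    ultimately show ?case
      by eventually_elim (simp add: fA)
  next
    case (UN K)
    then obtain k where k: "k \<in> K" "M \<in> k" by blast
    then have "\<forall>\<^sub>F i in F. N i \<in> k" using UN by blast
    then show ?case by (rule eventually_mono) (use k in blast)
  qed (auto simp: eventually_conj_iff)
  then show ?L
    unfolding limitin_def using R by (simp add: topspace_weak_topology)
qed

definition lsc_map :: "'a topology \<Rightarrow> ('a \<Rightarrow> real) \<Rightarrow> bool" where
  "lsc_map X f \<longleftrightarrow> (\<forall>a. openin X {x \<in> topspace X. a < f x})"

definition usc_multifunction :: "('x::topological_space \<Rightarrow> 'u::topological_space set) \<Rightarrow> bool" where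
  "usc_multifunction F \<longleftrightarrow> (\<forall>G. open G \<longrightarrow> open {x. F x \<subseteq> G})"

definition measurable_multifunction ::
    "('x::topological_space \<Rightarrow> 'u::topological_space set) \<Rightarrow> bool" where
  "measurable_multifunction F \<longleftrightarrow> (\<forall>G. open G \<longrightarrow> {x. F x \<inter> G \<noteq> {}} \<in> sets borel)"

definition is_minimum_on :: "('u \<Rightarrow> real) \<Rightarrow> 'u set \<Rightarrow> real \<Rightarrow> bool" where
  "is_minimum_on f S m \<longleftrightarrow> (\<exists>u\<in>S. f u = m) \<and> (\<forall>u\<in>S. m \<le> f u)"

section \<open>Histories and function spaces\<close>

text \<open>A history \<open>(x\<^sub>1, \<dots>, x\<^sub>t)\<close> is an element \<open>h\<close> of the space of the product measure space over
  the index set \<open>{1..t}\<close>; its last component is \<open>h t\<close> and \<open>h(Suc t := x)\<close> is the history extended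
  by \<open>x\<close>.  A sequence \<open>(Z\<^sub>t, \<dots>, Z\<^sub>T)\<close> is a function \<open>Z\<close> on time indices, of which only the values
  at \<open>s \<in> {t..T}\<close> matter, and each \<open>Z s\<close> matters only on histories of length \<open>s\<close>.\<close>

definition hist :: "nat \<Rightarrow> (nat \<Rightarrow> 'x::polish_space) measure" where
  "hist t = PiM {1..t} (\<lambda>_. borel)"

definition bounded_measurable :: "'a measure \<Rightarrow> ('a \<Rightarrow> real) set" where
  "bounded_measurable M = {f \<in> borel_measurable M. bounded (f ` space M)}"

abbreviation Zspace :: "nat \<Rightarrow> ((nat \<Rightarrow> 'x::polish_space) \<Rightarrow> real) set" where
  "Zspace t \<equiv> bounded_measurable (hist t)"

abbreviation Zspaces ::
    "nat \<Rightarrow> nat \<Rightarrow> (nat \<Rightarrow> (nat \<Rightarrow> 'x::polish_space) \<Rightarrow> real) set" where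
  "Zspaces t T \<equiv> Pi {t..T} Zspace"

section \<open>Controlled Markov systems\<close>

abbreviation graph_of :: "('x \<Rightarrow> 'u set) \<Rightarrow> ('x \<times> 'u) set" where
  "graph_of F \<equiv> Sigma UNIV F"

text \<open>The control space is a Borel subset \<open>CS\<close> of a Polish space.  As usual for
  multifunctions of admissible controls, the sets \<open>U t x\<close> are nonempty.\<close>

definition controlled_markov_system ::
    "nat \<Rightarrow> 'u::polish_space set \<Rightarrow> (nat \<Rightarrow> 'x::polish_space \<Rightarrow> 'u set)
      \<Rightarrow> (nat \<Rightarrow> 'x \<Rightarrow> 'u \<Rightarrow> 'x measure) \<Rightarrow> bool" where
  "controlled_markov_system T CS U Q \<longleftrightarrow>
     1 \<le> T \<and> CS \<in> sets borel \<and>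
     (\<forall>t\<in>{1..T}. (\<forall>x. U t x \<noteq> {} \<and> U t x \<subseteq> CS) \<and> measurable_multifunction (U t)) \<and>
     (\<forall>t\<in>{1..<T}. (\<lambda>(x, u). Q t x u)
        \<in> restrict_space borel (graph_of (U t)) \<rightarrow>\<^sub>M prob_algebra borel)"

definition cost_functions ::
    "nat \<Rightarrow> (nat \<Rightarrow> 'x::polish_space \<Rightarrow> 'u::polish_space set)
      \<Rightarrow> (nat \<Rightarrow> 'x \<Rightarrow> 'u \<Rightarrow> real) set" where
  "cost_functions T U = {c. \<forall>t\<in>{1..T}.
     (\<lambda>(x, u). c t x u) \<in> bounded_measurable (restrict_space borel (graph_of (U t)))}"

type_synonym ('x, 'u) policy = "nat \<Rightarrow> (nat \<Rightarrow> 'x) \<Rightarrow> 'u"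

definition policies ::
    "nat \<Rightarrow> (nat \<Rightarrow> 'x::polish_space \<Rightarrow> 'u::polish_space set) \<Rightarrow> ('x, 'u) policy set" where
  "policies T U = {\<pi>. \<forall>t\<in>{1..T}. \<pi> t \<in> hist t \<rightarrow>\<^sub>M borel \<and>
     (\<forall>h\<in>space (hist t). \<pi> t h \<in> U t (h t))}"

definition markov_policies ::
    "nat \<Rightarrow> (nat \<Rightarrow> 'x::polish_space \<Rightarrow> 'u::polish_space set) \<Rightarrow> ('x, 'u) policy set" where
  "markov_policies T U = {\<pi> \<in> policies T U. \<forall>t\<in>{1..T}. \<exists>\<phi> :: 'x \<Rightarrow> 'u.
     \<forall>h\<in>space (hist t). \<pi> t h = \<phi> (h t)}"

section \<open>Dynamic risk measures\<close>

text \<open>\<open>\<rho> \<pi> t\<close> stands for the conditional risk measure with index \<open>t\<close> of policy \<open>\<pi>\<close>.  Monotonicity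
  forces \<open>\<rho> \<pi> t Z\<close> to depend only on the values of \<open>Z s\<close>, \<open>s \<in> {t..T}\<close>, on histories of length \<open>s\<close>.
  Policies that differ only off the histories are formally distinct indices; this loses no
  generality, since a family indexed by policies on histories extends to them by restricting \<open>\<pi>\<close>.\<close>

type_synonym ('x, 'u) risk_family =
  "('x, 'u) policy \<Rightarrow> nat \<Rightarrow> (nat \<Rightarrow> (nat \<Rightarrow> 'x) \<Rightarrow> real) \<Rightarrow> (nat \<Rightarrow> 'x) \<Rightarrow> real"

definition conditional_risk_measure ::
    "nat \<Rightarrow> nat \<Rightarrow> ((nat \<Rightarrow> (nat \<Rightarrow> 'x::polish_space) \<Rightarrow> real) \<Rightarrow> (nat \<Rightarrow> 'x) \<Rightarrow> real) \<Rightarrow> bool" where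
  "conditional_risk_measure T t r \<longleftrightarrow>
     r \<in> Zspaces t T \<rightarrow> Zspace t \<and>
     (\<forall>Z\<in>Zspaces t T. \<forall>W\<in>Zspaces t T.
        (\<forall>s\<in>{t..T}. \<forall>h\<in>space (hist s). Z s h \<le> W s h) \<longrightarrow>
        (\<forall>h\<in>space (hist t). r Z h \<le> r W h))"

definition normalized_crm ::
    "nat \<Rightarrow> ((nat \<Rightarrow> (nat \<Rightarrow> 'x::polish_space) \<Rightarrow> real) \<Rightarrow> (nat \<Rightarrow> 'x) \<Rightarrow> real) \<Rightarrow> bool" where
  "normalized_crm t r \<longleftrightarrow> (\<forall>h\<in>space (hist t). r (\<lambda>_ _. 0) h = 0)"

definition translation_invariant_crm ::
    "nat \<Rightarrow> nat \<Rightarrow> ((nat \<Rightarrow> (nat \<Rightarrow> 'x::polish_space) \<Rightarrow> real) \<Rightarrow> (nat \<Rightarrow> 'x) \<Rightarrow> real) \<Rightarrow> bool" where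
  "translation_invariant_crm T t r \<longleftrightarrow>
     (\<forall>Z\<in>Zspaces t T. \<forall>h\<in>space (hist t). r Z h = Z t h + r (Z(t := \<lambda>_. 0)) h)"

definition family_of_dynamic_risk_measures ::
    "nat \<Rightarrow> (nat \<Rightarrow> 'x::polish_space \<Rightarrow> 'u::polish_space set) \<Rightarrow> ('x, 'u) risk_family \<Rightarrow> bool" where
  "family_of_dynamic_risk_measures T U \<rho> \<longleftrightarrow>
     (\<forall>\<pi>\<in>policies T U. \<forall>t\<in>{1..T}. conditional_risk_measure T t (\<rho> \<pi> t))"

definition normalized_family ::
    "nat \<Rightarrow> (nat \<Rightarrow> 'x::polish_space \<Rightarrow> 'u::polish_space set) \<Rightarrow> ('x, 'u) risk_family \<Rightarrow> bool" where
  "normalized_family T U \<rho> \<longleftrightarrow>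
     (\<forall>\<pi>\<in>policies T U. \<forall>t\<in>{1..T}. normalized_crm t (\<rho> \<pi> t))"

definition translation_invariant_family ::
    "nat \<Rightarrow> (nat \<Rightarrow> 'x::polish_space \<Rightarrow> 'u::polish_space set) \<Rightarrow> ('x, 'u) risk_family \<Rightarrow> bool" where
  "translation_invariant_family T U \<rho> \<longleftrightarrow>
     (\<forall>\<pi>\<in>policies T U. \<forall>t\<in>{1..T}. translation_invariant_crm T t (\<rho> \<pi> t))"

definition stochastically_conditionally_time_consistent ::
    "nat \<Rightarrow> (nat \<Rightarrow> 'x::polish_space \<Rightarrow> 'u::polish_space set)
      \<Rightarrow> (nat \<Rightarrow> 'x \<Rightarrow> 'u \<Rightarrow> 'x measure) \<Rightarrow> ('x, 'u) risk_family \<Rightarrow> bool" where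
  "stochastically_conditionally_time_consistent T U Q \<rho> \<longleftrightarrow>
     (\<forall>\<pi>\<in>policies T U. \<forall>\<pi>'\<in>policies T U. \<forall>t\<in>{1..<T}. \<forall>h\<in>space (hist t).
      \<forall>Z\<in>Zspaces t T. \<forall>W\<in>Zspaces t T.
        Z t h = W t h \<longrightarrow>
        (\<forall>\<eta>::real.
           measure (Q t (h t) (\<pi> t h)) {x. \<rho> \<pi> (Suc t) Z (h(Suc t := x)) > \<eta>}
           \<le> measure (Q t (h t) (\<pi>' t h)) {x. \<rho> \<pi>' (Suc t) W (h(Suc t := x)) > \<eta>}) \<longrightarrow>
        \<rho> \<pi> t Z h \<le> \<rho> \<pi>' t W h)"

definition policy_value ::
    "('x, 'u) risk_family \<Rightarrow> (nat \<Rightarrow> 'x \<Rightarrow> 'u \<Rightarrow> real) \<Rightarrow> ('x, 'u) policy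
      \<Rightarrow> nat \<Rightarrow> (nat \<Rightarrow> 'x) \<Rightarrow> real" where
  "policy_value \<rho> c \<pi> t = \<rho> \<pi> t (\<lambda>s h. c s (h s) (\<pi> s h))"

definition markov_family ::
    "nat \<Rightarrow> (nat \<Rightarrow> 'x::polish_space \<Rightarrow> 'u::polish_space set) \<Rightarrow> ('x, 'u) risk_family \<Rightarrow> bool" where
  "markov_family T U \<rho> \<longleftrightarrow>
     (\<forall>\<pi>\<in>markov_policies T U. \<forall>c\<in>cost_functions T U. \<forall>t\<in>{1..T}.
      \<forall>h\<in>space (hist t). \<forall>h'\<in>space (hist t).
        h t = h' t \<longrightarrow> policy_value \<rho> c \<pi> t h = policy_value \<rho> c \<pi> t h')"

definition transition_risk_mappings ::
    "nat \<Rightarrow> (nat \<Rightarrow> 'x::polish_space \<Rightarrow> 'u::polish_space set)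
      \<Rightarrow> (nat \<Rightarrow> 'x \<Rightarrow> 'u \<Rightarrow> 'x measure) \<Rightarrow> ('x, 'u) risk_family
      \<Rightarrow> (nat \<Rightarrow> 'x \<Rightarrow> 'x measure \<Rightarrow> ('x \<Rightarrow> real) \<Rightarrow> real) \<Rightarrow> bool" where
  "transition_risk_mappings T U Q \<rho> \<sigma> \<longleftrightarrow>
     (\<forall>t\<in>{1..<T}.
       (\<forall>x. \<forall>q\<in>Q t x ` U t x. \<sigma> t x q (\<lambda>_. 0) = 0) \<and>
       (\<forall>x. \<forall>q1\<in>Q t x ` U t x. \<forall>q2\<in>Q t x ` U t x.
        \<forall>v1\<in>bounded_measurable borel. \<forall>v2\<in>bounded_measurable borel.
          (\<forall>\<eta>::real. measure q1 {y. v1 y > \<eta>} \<le> measure q2 {y. v2 y > \<eta>}) \<longrightarrow>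
          \<sigma> t x q1 v1 \<le> \<sigma> t x q2 v2) \<and>
       (\<forall>\<pi>\<in>policies T U. \<forall>c\<in>cost_functions T U. \<forall>h\<in>space (hist t).
          policy_value \<rho> c \<pi> t h = c t (h t) (\<pi> t h) +
            \<sigma> t (h t) (Q t (h t) (\<pi> t h)) (\<lambda>x. policy_value \<rho> c \<pi> (Suc t) (h(Suc t := x)))))"

section \<open>Value functions and optimal policies\<close>

text \<open>Every feasible policy \<open>(\<pi>\<^sub>t, \<dots>, \<pi>\<^sub>T)\<close> from \<open>h\<^sub>t\<close> on is the tail of a policy in
  \<open>policies T U\<close>, and the value at \<open>h\<^sub>t\<close> depends on that tail only, so the infimum is taken
  over all of \<open>policies T U\<close>.  The infimum is that of a set of reals; under the hypotheses of the
  theorem the values are bounded below uniformly in the policy.\<close>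

definition value_function ::
    "nat \<Rightarrow> (nat \<Rightarrow> 'x::polish_space \<Rightarrow> 'u::polish_space set) \<Rightarrow> ('x, 'u) risk_family
      \<Rightarrow> (nat \<Rightarrow> 'x \<Rightarrow> 'u \<Rightarrow> real) \<Rightarrow> nat \<Rightarrow> (nat \<Rightarrow> 'x) \<Rightarrow> real" where
  "value_function T U \<rho> c t h = (INF \<pi>\<in>policies T U. policy_value \<rho> c \<pi> t h)"

definition optimal_policy ::
    "nat \<Rightarrow> (nat \<Rightarrow> 'x::polish_space \<Rightarrow> 'u::polish_space set) \<Rightarrow> ('x, 'u) risk_family
      \<Rightarrow> (nat \<Rightarrow> 'x \<Rightarrow> 'u \<Rightarrow> real) \<Rightarrow> ('x, 'u) policy \<Rightarrow> bool" where
  "optimal_policy T U \<rho> c \<pi> \<longleftrightarrow> \<pi> \<in> policies T U \<and>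
     (\<forall>h\<in>space (hist 1). policy_value \<rho> c \<pi> 1 h = value_function T U \<rho> c 1 h)"

end

theory Submission
  imports Defs
begin

text \<open>
  The proof is backward induction on the Bellman recursion
  \<open>w\<^sub>t(x) = min\<^sub>u {c\<^sub>t(x, u) + \<sigma>\<^sub>t(x, Q\<^sub>t(x, u), w\<^sub>t\<^sub>+\<^sub>1)}\<close>, in which three things have to be
  propagated from \<open>w\<^sub>t\<^sub>+\<^sub>1\<close> to \<open>w\<^sub>t\<close>: that the minimum is attained, that the result is again
  lower semicontinuous and bounded, and that a minimizer can be chosen Borel measurably in \<open>x\<close>.

  If \<open>w\<^sub>t\<^sub>+\<^sub>1\<close> is bounded and lower semicontinuous, then the function of \<open>(x, u)\<close> inside the
  braces is lower semicontinuous, being the sum of \<open>c\<^sub>t\<close> and of the composition of the lower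
  semicontinuous map \<open>\<sigma>\<^sub>t(\<cdot>, \<cdot>, w\<^sub>t\<^sub>+\<^sub>1)\<close> with the weakly continuous map
  \<open>(x, u) \<mapsto> (x, Q\<^sub>t(x, u))\<close> (\<open>lsc_map_one_step_cost\<close>).  Minimizing such a function
  over the values of a compact-valued upper semicontinuous multifunction gives a lower
  semicontinuous function, by the tube argument of \<open>open_graph_section_subset\<close>, and the sets of
  minimizers are compact and depend measurably on \<open>x\<close>, so they have a Borel selector
  (\<open>argmin_selection\<close>, based on \<open>measurable_selection_compact\<close>).

  Boundedness of \<open>w\<^sub>t\<close> needs a bound on \<open>\<sigma>\<^sub>t(x, Q\<^sub>t(x, u), v)\<close> that is uniform in \<open>(x, u)\<close>.  By
  monotonicity it suffices to bound it for constant \<open>v\<close>.  A constant has the same distribution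
  under all probability measures, so the value then does not depend on \<open>u\<close>; it is therefore the
  risk at time \<open>t\<close>, under any fixed policy, of the cost sequence whose only nonzero term is that
  constant at time \<open>t + 1\<close>, and this is a bounded function of the history
  (\<open>transition_risk_bounded\<close>).

  Finally the solution \<open>w\<close> of the recursion is compared with the values of policies.  Because
  \<open>\<sigma>\<^sub>t\<close> is monotone in its last argument, every history-dependent policy has value at least \<open>w\<close>
  (\<open>policy_value_lower_bound\<close>), while the Markov policy made of the selected minimizers has value
  exactly \<open>w\<close> (\<open>policy_value_of_selector\<close>).  Hence the infimum over all policies is \<open>w\<close>, a
  function of the current state only, and it is attained by a Markov policy.\<close>

section \<open>Lower semicontinuous functions\<close>

lemma lsc_map_compose:
  assumes g: "continuous_map X Y g" and f: "lsc_map Y f"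
  shows "lsc_map X (\<lambda>x. f (g x))"
  unfolding lsc_map_def
proof
  fix a
  have "openin X {x \<in> topspace X. g x \<in> {y \<in> topspace Y. a < f y}}"
    using f by (intro openin_continuous_map_preimage[OF g]) (simp add: lsc_map_def)
  moreover have "{x \<in> topspace X. g x \<in> {y \<in> topspace Y. a < f y}} = {x \<in> topspace X. a < f (g x)}"
    using continuous_map_image_subset_topspace[OF g] by blast
  ultimately show "openin X {x \<in> topspace X. a < f (g x)}"
    by simp
qed

lemma lsc_map_add:
  assumes f: "lsc_map X f" and g: "lsc_map X g"
  shows "lsc_map X (\<lambda>x. f x + g x)"
  unfolding lsc_map_def
proof
  fix a
  have "(\<exists>r. r < f x \<and> a - r < g x) \<longleftrightarrow> a < f x + g x" for x
    using dense[of "a - g x" "f x"] by (auto simp: algebra_simps intro: add_strict_mono)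
  then have "{x \<in> topspace X. a < f x + g x} =
    (\<Union>r. {x \<in> topspace X. r < f x} \<inter> {x \<in> topspace X. a - r < g x})"
    by blast
  moreover have "openin X \<dots>"
    using f g unfolding lsc_map_def by (intro openin_Union) (auto intro!: openin_Int)
  ultimately show "openin X {x \<in> topspace X. a < f x + g x}"
    by simp
qed

lemma borel_measurable_lsc_map:
  assumes "lsc_map euclidean f"
  shows "f \<in> borel_measurable borel"
  using assms unfolding borel_measurable_iff_greater lsc_map_def by simp

text \<open>The set of points of the graph where a lower semicontinuous function exceeds \<open>a\<close> is only
  relatively open.  The arguments below use the trace representation by an open subset of the full
  product, because its sections and tubes are open in the factors.\<close>
lemma lsc_map_graphE:
  fixes F :: "'x::topological_space \<Rightarrow> 'u::topological_space set"
  assumes "lsc_map (subtopology euclidean (graph_of F)) (\<lambda>(x, u). f x u)"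
  obtains V where "open V" "\<And>x u. u \<in> F x \<Longrightarrow> (x, u) \<in> V \<longleftrightarrow> a < f x u"
proof -
  have "openin (top_of_set (graph_of F)) {z \<in> graph_of F. a < (case z of (x, u) \<Rightarrow> f x u)}"
    using assms unfolding lsc_map_def by simp
  then obtain V where V: "open V"
    "{z \<in> graph_of F. a < (case z of (x, u) \<Rightarrow> f x u)} = graph_of F \<inter> V"
    unfolding openin_open by blast
  have "(x, u) \<in> V \<longleftrightarrow> a < f x u" if "u \<in> F x" for x u
  proof -
    have "(x, u) \<in> {z \<in> graph_of F. a < (case z of (x, u) \<Rightarrow> f x u)} \<longleftrightarrow> (x, u) \<in> graph_of F \<inter> V"
      using V(2) by simp
    then show ?thesis using that by simp
  qed
  with V(1) show ?thesis by (rule that)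
qed

text \<open>If no point of \<open>K\<close> were a minimizer, the sets of points that are beaten by a fixed
  \<open>u'\<close>, namely \<open>{u. f x u' < f x u}\<close>, would be an open cover of \<open>K\<close>; the best of the finitely
  many \<open>u'\<close> of a subcover is not beaten by any of them.\<close>
lemma lsc_attains_min_on_compact:
  fixes F :: "'x::topological_space \<Rightarrow> 'u::t2_space set"
  assumes lsc: "lsc_map (subtopology euclidean (graph_of F)) (\<lambda>(x, u). f x u)"
    and K: "compact K" "K \<subseteq> F x" "K \<noteq> {}"
  shows "\<exists>u\<in>K. \<forall>u'\<in>K. f x u \<le> f x u'"
proof -
  have "\<exists>V. open V \<and> (\<forall>u\<in>K. u \<in> V \<longleftrightarrow> a < f x u)" for a
  proof -
    obtain V where V: "open V" "\<And>x u. u \<in> F x \<Longrightarrow> (x, u) \<in> V \<longleftrightarrow> a < f x u"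
      using lsc_map_graphE[OF lsc] by blast
    have "open (Pair x -` V)"
      by (rule open_vimage[OF V(1)]) (intro continuous_intros)
    with V(2) K(2) show ?thesis
      by (intro exI[of _ "Pair x -` V"]) auto
  qed
  then obtain V where V: "\<And>a. open (V a)" "\<And>a u. u \<in> K \<Longrightarrow> u \<in> V a \<longleftrightarrow> a < f x u"
    by metis
  show ?thesis
  proof (rule ccontr)
    assume "\<not> ?thesis"
    then have "K \<subseteq> (\<Union>u'\<in>K. V (f x u'))"
      using V(2) by (force simp: not_le)
    then obtain C where C: "C \<subseteq> K" "finite C" "K \<subseteq> (\<Union>u'\<in>C. V (f x u'))"
      using compactE_image[OF K(1), of K "\<lambda>u'. V (f x u')"] V(1) by blast
    then have "C \<noteq> {}" using K(3) by auto
    then obtain u where u: "u \<in> C" "\<forall>u'\<in>C. f x u \<le> f x u'"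
      using C(2) by (metis arg_min_if_finite(1,2) not_less)
    then obtain u' where "u' \<in> C" "u \<in> V (f x u')"
      using C by blast
    then have "f x u' < f x u"
      using V(2) u(1) C(1) by blast
    with u \<open>u' \<in> C\<close> show False by force
  qed
qed

section \<open>Compact-valued upper semicontinuous multifunctions\<close>

text \<open>Compactness of \<open>F x\<close> thickens \<open>{x} \<times> F x \<subseteq> V\<close> to a product \<open>A \<times> G \<subseteq> V\<close> of open
  sets.  The set \<open>F y\<close> varies with \<open>y\<close>, so the tube must contain an open neighbourhood \<open>G\<close> of
  \<open>F x\<close>; upper semicontinuity keeps \<open>F y\<close> inside \<open>G\<close> for \<open>y\<close> near \<open>x\<close>.\<close>
lemma open_graph_section_subset:
  fixes F :: "'x::topological_space \<Rightarrow> 'u::topological_space set"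
  assumes F: "usc_multifunction F" "\<And>x. compact (F x)" and V: "open V"
  shows "open {x. \<forall>u\<in>F x. (x, u) \<in> V}"
proof (rule Topological_Spaces.openI)
  fix x assume "x \<in> {x. \<forall>u\<in>F x. (x, u) \<in> V}"
  then have "{x} \<times> F x \<subseteq> V" by auto
  have "\<exists>A G. open A \<and> open G \<and> x \<in> A \<and> u \<in> G \<and> A \<times> G \<subseteq> V" if "u \<in> F x" for u
  proof -
    have "(x, u) \<in> V" using \<open>{x} \<times> F x \<subseteq> V\<close> that by auto
    from open_prod_elim[OF V this]
    obtain A G where "open A" "open G" "(x, u) \<in> A \<times> G" "A \<times> G \<subseteq> V" .
    then show ?thesis by auto
  qed
  then have "\<forall>u\<in>F x. \<exists>A G. open A \<and> open G \<and> x \<in> A \<and> u \<in> G \<and> A \<times> G \<subseteq> V"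
    by blast
  then obtain A G where
    AG: "\<forall>u\<in>F x. open (A u) \<and> open (G u) \<and> x \<in> A u \<and> u \<in> G u \<and> A u \<times> G u \<subseteq> V"
    unfolding bchoice_iff by blast
  obtain C where C: "C \<subseteq> F x" "finite C" "F x \<subseteq> (\<Union>u\<in>C. G u)"
    by (rule compactE_image[OF F(2)[of x], of "F x" G]) (use AG in auto)
  let ?A = "(\<Inter>u\<in>C. A u)" and ?G = "\<Union>u\<in>C. G u"
  have "open ?G" "open ?A" using C AG by (auto intro!: open_UN open_INT)
  then have "open (?A \<inter> {y. F y \<subseteq> ?G})"
    using F(1) unfolding usc_multifunction_def by blast
  moreover have "x \<in> ?A \<inter> {y. F y \<subseteq> ?G}"
    using C AG by auto
  moreover have "?A \<inter> {y. F y \<subseteq> ?G} \<subseteq> {x. \<forall>u\<in>F x. (x, u) \<in> V}"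
  proof clarify
    fix y u assume y: "y \<in> ?A" "F y \<subseteq> ?G" and u: "u \<in> F y"
    then obtain z where "z \<in> C" "u \<in> G z" by blast
    then have "(y, u) \<in> A z \<times> G z" using y(1) by simp
    then show "(y, u) \<in> V" using AG C(1) \<open>z \<in> C\<close> by blast
  qed
  ultimately show "\<exists>S. open S \<and> x \<in> S \<and> S \<subseteq> {x. \<forall>u\<in>F x. (x, u) \<in> V}"
    by blast
qed

text \<open>For \<open>C = UNIV\<close> this is lower semicontinuity of the minimum over \<open>F x\<close>; a general closed
  \<open>C\<close> is what the measurability of the sets of minimizers requires.\<close>
lemma open_lsc_greater_on_values:
  fixes F :: "'x::topological_space \<Rightarrow> 'u::topological_space set"
  assumes F: "usc_multifunction F" "\<And>x. compact (F x)"
    and lsc: "lsc_map (subtopology euclidean (graph_of F)) (\<lambda>(x, u). f x u)"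
    and C: "closed C"
  shows "open {x. \<forall>u\<in>F x \<inter> C. a < f x u}"
proof -
  obtain V where V: "open V" "\<And>x u. u \<in> F x \<Longrightarrow> (x, u) \<in> V \<longleftrightarrow> a < f x u"
    using lsc_map_graphE[OF lsc] by blast
  have "open (V \<union> UNIV \<times> (- C))"
    using V(1) C by (intro open_Un open_Times) auto
  from open_graph_section_subset[OF F this]
  have "open {x. \<forall>u\<in>F x. (x, u) \<in> V \<union> UNIV \<times> (- C)}" .
  moreover have "{x. \<forall>u\<in>F x. (x, u) \<in> V \<union> UNIV \<times> (- C)} = {x. \<forall>u\<in>F x \<inter> C. a < f x u}"
    using V(2) by auto
  ultimately show ?thesis by simp
qed

section \<open>Measurable selection\<close>

lemma compact_decseq_common_point:
  fixes S :: "nat \<Rightarrow> 'u::t2_space set"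
  assumes "decseq S" "\<And>k. compact (S k)" "\<And>k. S k \<noteq> {}"
  obtains u where "\<And>k. u \<in> S k"
proof -
  have "S 0 \<inter> (\<Inter>k. S k) \<noteq> {}"
  proof (rule compact_imp_fip_image)
    show "S 0 \<inter> (\<Inter>k\<in>I. S k) \<noteq> {}" if "finite I" for I
    proof -
      have "S (Max (insert 0 I)) \<subseteq> S k" if "k \<in> insert 0 I" for k
        using that \<open>finite I\<close> by (intro decseqD[OF assms(1)] Max_ge) auto
      then have "S (Max (insert 0 I)) \<subseteq> S 0 \<inter> (\<Inter>k\<in>I. S k)"
        by blast
      with assms(3)[of "Max (insert 0 I)"] show ?thesis
        by (metis subset_empty)
    qed
  qed (use assms compact_imp_closed in auto)
  then show ?thesis using that by blast
qed

text \<open>Stage \<open>k\<close> cuts the set down to the first ball of radius \<open>2\<^sup>-\<^sup>k\<close> that it meets, in the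
  enumeration of centres \<open>d\<close>.  Choosing the least index makes the choice canonical, hence
  measurable when the set varies.\<close>
primrec shrink :: "(nat \<Rightarrow> 'u::metric_space) \<Rightarrow> 'u set \<Rightarrow> nat \<Rightarrow> 'u set" where
  "shrink d S 0 = S"
| "shrink d S (Suc k) = shrink d S k \<inter>
     cball (d (LEAST n. shrink d S k \<inter> cball (d n) ((1/2) ^ k) \<noteq> {})) ((1/2) ^ k)"

text \<open>A form of the Kuratowski--Ryll-Nardzewski theorem.  Along the cuts the set shrinks to a
  single point, which is the limit of the chosen centres.  There are only countably many centres, so
  the hypothesis on closed sets \<open>C\<close> is inherited from each stage by the next (absorb the new ball
  into \<open>C\<close>), and the chosen centres depend measurably on \<open>x\<close>.  Compactness makes the limit a point
  of the original set.\<close>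
lemma measurable_selection_compact:
  fixes M :: "'a \<Rightarrow> 'u::polish_space set"
  assumes compact: "\<And>x. x \<in> space N \<Longrightarrow> compact (M x)"
    and nonempty: "\<And>x. x \<in> space N \<Longrightarrow> M x \<noteq> {}"
    and meas: "\<And>C. closed C \<Longrightarrow> {x \<in> space N. M x \<inter> C \<noteq> {}} \<in> sets N"
  shows "\<exists>\<phi>\<in>borel_measurable N. \<forall>x\<in>space N. \<phi> x \<in> M x"
proof -
  obtain D :: "'u set" where D: "countable D" "\<And>X. open X \<Longrightarrow> X \<noteq> {} \<Longrightarrow> \<exists>d\<in>D. d \<in> X"
    by (rule countable_dense_setE) blast
  then have "D \<noteq> {}" using open_UNIV by blast
  define d where "d = from_nat_into D"
  have d_dense: "\<exists>n. dist (d n) u < e" if "e > 0" for u e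
  proof -
    have "ball u e \<noteq> {}" using that by auto
    then obtain z where "z \<in> D" "z \<in> ball u e"
      using D(2) open_ball by blast
    then show ?thesis
      using from_nat_into_surj[OF D(1), of z] by (auto simp: d_def dist_commute)
  qed
  let ?S = "\<lambda>k x. shrink d (M x) k"
  let ?i = "\<lambda>k x. LEAST n. ?S k x \<inter> cball (d n) ((1/2) ^ k) \<noteq> {}"
  have i_meas: "?i k \<in> measurable N (count_space UNIV)"
    if "\<forall>C. closed C \<longrightarrow> {x \<in> space N. ?S k x \<inter> C \<noteq> {}} \<in> sets N" for k
  proof -
    have [measurable]: "Measurable.pred N (\<lambda>x. ?S k x \<inter> cball (d n) ((1/2) ^ k) \<noteq> {})" for n
      using that by (simp add: pred_def)
    show ?thesis by measurable
  qed
  have S_meas: "\<forall>C. closed C \<longrightarrow> {x \<in> space N. ?S k x \<inter> C \<noteq> {}} \<in> sets N" for k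
  proof (induction k)
    case 0
    then show ?case using meas by simp
  next
    case (Suc k)
    note [measurable] = i_meas[OF Suc]
    show ?case
    proof (intro allI impI)
      fix C :: "'u set" assume C: "closed C"
      have [measurable]: "Measurable.pred N (\<lambda>x. ?S k x \<inter> (cball (d n) ((1/2) ^ k) \<inter> C) \<noteq> {})" for n
        using Suc C by (simp add: pred_def closed_Int)
      have "{x \<in> space N. ?S (Suc k) x \<inter> C \<noteq> {}} =
        {x \<in> space N. \<exists>n. ?i k x = n \<and> ?S k x \<inter> (cball (d n) ((1/2) ^ k) \<inter> C) \<noteq> {}}"
        by (simp add: Int_assoc)
      also have "\<dots> \<in> sets N"
        by measurable
      finally show "{x \<in> space N. ?S (Suc k) x \<inter> C \<noteq> {}} \<in> sets N" .
    qed
  qed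
  have S_compact: "compact (?S k x)" if "x \<in> space N" for k x
    using compact[OF that] by (induction k) (auto intro: compact_Int_closed)
  have S_nonempty: "?S k x \<noteq> {}" if "x \<in> space N" for k x
  proof (induction k)
    case 0
    then show ?case using nonempty[OF that] by simp
  next
    case (Suc k)
    then obtain u where "u \<in> ?S k x" by blast
    moreover obtain n where "dist (d n) u < (1/2) ^ k"
      using d_dense[of "(1/2) ^ k" u] by auto
    ultimately have "?S k x \<inter> cball (d n) ((1/2) ^ k) \<noteq> {}"
      by auto
    then show ?case
      by (simp only: shrink.simps) (rule LeastI)
  qed
  have "\<exists>u. \<forall>k. u \<in> ?S k x" if "x \<in> space N" for x
  proof -
    have "decseq (\<lambda>k. ?S k x)"
      by (rule decseq_SucI) auto
    \<comment> \<open>Balls need not be compact in \<open>'u\<close>; it is the compactness of \<open>M x\<close> that gives a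
      common point.\<close>
    from compact_decseq_common_point[OF this S_compact[OF that] S_nonempty[OF that]]
    show ?thesis by blast
  qed
  then obtain \<phi> where "\<forall>x\<in>space N. \<forall>k. \<phi> x \<in> ?S k x"
    using bchoice[of "space N" "\<lambda>x u. \<forall>k. u \<in> ?S k x"] by blast
  then have \<phi>: "\<phi> x \<in> ?S k x" if "x \<in> space N" for x k
    using that by blast
  have "(\<lambda>k. d (?i k x)) \<longlonglongrightarrow> \<phi> x" if "x \<in> space N" for x
  proof (rule metric_tendsto_imp_tendsto)
    show "(\<lambda>k. (1/2 :: real) ^ k) \<longlonglongrightarrow> 0"
      by (rule LIMSEQ_realpow_zero) auto
    have "dist (d (?i k x)) (\<phi> x) \<le> (1/2) ^ k" for k
      using \<phi>[OF that, of "Suc k"] by simp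
    then show "\<forall>\<^sub>F k in sequentially. dist (d (?i k x)) (\<phi> x) \<le> dist ((1/2 :: real) ^ k) 0"
      by simp
  qed
  moreover have "(\<lambda>x. d (?i k x)) \<in> borel_measurable N" for k
    by (rule measurable_compose[OF i_meas[OF S_meas]]) simp
  ultimately have "\<phi> \<in> borel_measurable N"
    by (rule borel_measurable_LIMSEQ_metric[rotated])
  moreover have "\<phi> x \<in> M x" if "x \<in> space N" for x
    using \<phi>[OF that, of 0] by simp
  ultimately show ?thesis by blast
qed

text \<open>The set of minimizers misses a closed set \<open>C\<close> at \<open>x\<close> exactly if the minimum over \<open>F x \<inter> C\<close>
  exceeds the minimum over \<open>F x\<close>, and then some rational number lies strictly between the two.  This
  writes the exceptional set as a countable union of sets that are Borel by lower
  semicontinuity of both minima.\<close>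
lemma argmin_selection:
  fixes F :: "'x::topological_space \<Rightarrow> 'u::polish_space set"
  assumes F: "usc_multifunction F" "\<And>x. compact (F x)" "\<And>x. F x \<noteq> {}"
    and lsc: "lsc_map (subtopology euclidean (graph_of F)) (\<lambda>(x, u). f x u)"
  shows "\<exists>\<phi>\<in>borel_measurable borel.
    (\<forall>x. is_arg_min (f x) (\<lambda>u. u \<in> F x) (\<phi> x)) \<and> lsc_map euclidean (\<lambda>x. f x (\<phi> x))"
proof -
  have "\<forall>x. \<exists>u. u \<in> F x \<and> (\<forall>u'\<in>F x. f x u \<le> f x u')"
    using lsc_attains_min_on_compact[OF lsc F(2) order.refl F(3)] by blast
  then obtain \<mu> where "\<forall>x. \<mu> x \<in> F x \<and> (\<forall>u'\<in>F x. f x (\<mu> x) \<le> f x u')"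
    unfolding choice_iff by blast
  then have \<mu>: "\<mu> x \<in> F x" "u \<in> F x \<Longrightarrow> f x (\<mu> x) \<le> f x u" for x u
    by blast+
  define m where "m x = f x (\<mu> x)" for x
  have "{x. a < m x} = {x. \<forall>u\<in>F x \<inter> UNIV. a < f x u}" for a
    using \<mu> unfolding m_def by (auto intro: less_le_trans)
  then have m_lsc: "lsc_map euclidean m"
    unfolding lsc_map_def using open_lsc_greater_on_values[OF F(1,2) lsc closed_UNIV] by simp
  then have [measurable]: "m \<in> borel_measurable borel"
    by (rule borel_measurable_lsc_map)
  let ?M = "\<lambda>x. {u \<in> F x. f x u \<le> m x}"
  have M_compact: "compact (?M x)" for x
  proof -
    obtain V where V: "open V" "\<And>y u. u \<in> F y \<Longrightarrow> (y, u) \<in> V \<longleftrightarrow> m x < f y u"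
      using lsc_map_graphE[OF lsc] by blast
    have "open (Pair x -` V)"
      by (rule open_vimage[OF V(1)]) (intro continuous_intros)
    then have "compact (F x \<inter> - (Pair x -` V))"
      using F(2) by (intro compact_Int_closed) auto
    moreover have "F x \<inter> - (Pair x -` V) = ?M x"
      using V(2) by auto
    ultimately show ?thesis by simp
  qed
  have M_meas: "{x. ?M x \<inter> C \<noteq> {}} \<in> sets borel" if C: "closed C" for C
  proof -
    have gap: "?M x \<inter> C = {} \<longleftrightarrow> (\<exists>r\<in>\<rat>. m x < r \<and> (\<forall>u\<in>F x \<inter> C. r < f x u))" for x
    proof
      assume "?M x \<inter> C = {}"
      then have gr: "m x < f x u" if "u \<in> F x \<inter> C" for u
        using that by force
      show "\<exists>r\<in>\<rat>. m x < r \<and> (\<forall>u\<in>F x \<inter> C. r < f x u)"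
      proof (cases "F x \<inter> C = {}")
        \<comment> \<open>The minimum over the empty set counts as infinite: any rational above \<open>m x\<close> will do.\<close>
        case True
        then show ?thesis
          using Rats_dense_in_real[of "m x" "m x + 1"] by auto
      next
        case False
        then obtain u where u: "u \<in> F x \<inter> C" "\<forall>u'\<in>F x \<inter> C. f x u \<le> f x u'"
          using lsc_attains_min_on_compact[OF lsc compact_Int_closed[OF F(2) C] inf_le1] by blast
        obtain r where "r \<in> \<rat>" "m x < r" "r < f x u"
          using Rats_dense_in_real[OF gr[OF u(1)]] by blast
        with u(2) show ?thesis by force
      qed
    qed force
    have [measurable]: "{x. \<forall>u\<in>F x \<inter> C. r < f x u} \<in> sets borel" for r
      using open_lsc_greater_on_values[OF F(1,2) lsc C] by simp
    have "{x. ?M x \<inter> C \<noteq> {}} =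
      - (\<Union>r\<in>\<rat>. {x \<in> space borel. m x < r} \<inter> {x. \<forall>u\<in>F x \<inter> C. r < f x u})"
      unfolding gap by auto
    also have "\<dots> \<in> sets borel"
      using countable_rat by (intro borel_comp sets.countable_UN') auto
    finally show ?thesis .
  qed
  have "?M x \<noteq> {}" for x
    using \<mu>(1)[of x] by (auto simp: m_def)
  with M_compact M_meas
  have "\<exists>\<phi>\<in>borel_measurable borel. \<forall>x\<in>space borel. \<phi> x \<in> ?M x"
    by (intro measurable_selection_compact) (simp_all only: space_borel UNIV_I simp_thms)
  then obtain \<phi> where \<phi>: "\<phi> \<in> borel_measurable borel" "\<And>x. \<phi> x \<in> ?M x"
    by (auto simp only: space_borel)
  have "f x (\<phi> x) = m x" for x
    using \<phi>(2)[of x] \<mu>(2)[of "\<phi> x" x] by (simp add: m_def)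
  moreover have "is_arg_min (f x) (\<lambda>u. u \<in> F x) (\<phi> x)" for x
    using \<phi>(2)[of x] \<mu>(2)[of _ x] by (fastforce simp: is_arg_min_linorder m_def)
  ultimately show ?thesis
    using \<phi>(1) m_lsc by (intro bexI[of _ \<phi>]) simp_all
qed

section \<open>Histories and policies\<close>

lemma extend_history_measurable:
  assumes "h \<in> space (hist t)"
  shows "(\<lambda>x. h(Suc t := x)) \<in> borel \<rightarrow>\<^sub>M hist (Suc t)"
  unfolding hist_def
proof (rule measurable_fun_upd[where J = "{1..t}"])
  show "{1..Suc t} = {1..t} \<union> {Suc t}" by auto
  show "(\<lambda>x. h) \<in> borel \<rightarrow>\<^sub>M PiM {1..t} (\<lambda>_. borel)"
    using assms by (intro measurable_const) (simp add: hist_def)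
qed simp

lemma extend_history_in_space: "h \<in> space (hist t) \<Longrightarrow> h(Suc t := x) \<in> space (hist (Suc t))"
  using measurable_space[OF extend_history_measurable[of h t], of x] by simp

lemma history_with_last_component:
  assumes "1 \<le> t"
  shows "\<exists>h\<in>space (hist t). h t = x"
  using assms by (intro bexI[of _ "\<lambda>s\<in>{1..t}. x"]) (auto simp: hist_def space_PiM)

lemma measurable_last_component: "1 \<le> t \<Longrightarrow> (\<lambda>h. h t) \<in> hist t \<rightarrow>\<^sub>M borel"
  unfolding hist_def by (rule measurable_component_singleton) simp

lemma policiesD:
  assumes "\<pi> \<in> policies T U" "1 \<le> t" "t \<le> T"
  shows "\<pi> t \<in> hist t \<rightarrow>\<^sub>M borel" "h \<in> space (hist t) \<Longrightarrow> \<pi> t h \<in> U t (h t)"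
  using assms unfolding policies_def by auto

lemma markov_policyI:
  assumes "\<And>t. 1 \<le> t \<Longrightarrow> t \<le> T \<Longrightarrow> \<phi> t \<in> borel_measurable borel"
    and "\<And>t x. 1 \<le> t \<Longrightarrow> t \<le> T \<Longrightarrow> \<phi> t x \<in> U t x"
  shows "(\<lambda>t h. \<phi> t (h t)) \<in> markov_policies T U"
proof -
  have "(\<lambda>h. \<phi> t (h t)) \<in> hist t \<rightarrow>\<^sub>M borel" if "1 \<le> t" "t \<le> T" for t
    using measurable_last_component[OF that(1)] assms(1)[OF that] by (rule measurable_compose)
  then show ?thesis
    using assms(2) unfolding markov_policies_def policies_def by auto
qed

lemma bounded_measurable_iff:
  "f \<in> bounded_measurable M \<longleftrightarrow>
    f \<in> borel_measurable M \<and> (\<exists>B. \<forall>x\<in>space M. \<bar>f x\<bar> \<le> B)"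
  unfolding bounded_measurable_def bounded_iff by simp

lemma bounded_measurable_compose:
  assumes f: "f \<in> bounded_measurable N" and g: "g \<in> M \<rightarrow>\<^sub>M N"
  shows "(\<lambda>x. f (g x)) \<in> bounded_measurable M"
proof -
  have "f \<in> borel_measurable N"
    using f by (simp add: bounded_measurable_iff)
  moreover obtain B where "\<forall>x\<in>space N. \<bar>f x\<bar> \<le> B"
    using f by (auto simp: bounded_measurable_iff)
  then have "\<forall>x\<in>space M. \<bar>f (g x)\<bar> \<le> B"
    using measurable_space[OF g] by blast
  ultimately show ?thesis
    using measurable_compose[OF g] unfolding bounded_measurable_iff by blast
qed

lemma const_in_bounded_measurable [simp]: "(\<lambda>_. a) \<in> bounded_measurable M"
  by (auto simp: bounded_measurable_iff)

lemma policy_costs_in_Zspaces: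
  assumes \<pi>: "\<pi> \<in> policies T U" and c: "c \<in> cost_functions T U" and t: "1 \<le> t"
  shows "(\<lambda>s h. c s (h s) (\<pi> s h)) \<in> Zspaces t T"
proof (intro Pi_I)
  fix s assume "s \<in> {t..T}"
  with t have s: "1 \<le> s" "s \<le> T" by auto
  have "(\<lambda>h. (h s, \<pi> s h)) \<in> hist s \<rightarrow>\<^sub>M restrict_space borel (graph_of (U s))"
  proof (rule measurable_restrict_space2)
    show "(\<lambda>h. (h s, \<pi> s h)) \<in> space (hist s) \<rightarrow> graph_of (U s)"
      using policiesD(2)[OF \<pi> s] by auto
    show "(\<lambda>h. (h s, \<pi> s h)) \<in> hist s \<rightarrow>\<^sub>M borel"
      unfolding borel_prod[symmetric]
      using measurable_last_component[OF s(1)] policiesD(1)[OF \<pi> s] by (rule measurable_Pair)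
  qed
  moreover have "(\<lambda>(x, u). c s x u) \<in> bounded_measurable (restrict_space borel (graph_of (U s)))"
    using c s unfolding cost_functions_def by auto
  ultimately have "(\<lambda>h. (\<lambda>(x, u). c s x u) (h s, \<pi> s h)) \<in> Zspace s"
    by (rule bounded_measurable_compose[rotated])
  then show "(\<lambda>h. c s (h s) (\<pi> s h)) \<in> Zspace s"
    by simp
qed

section \<open>Values of policies\<close>

text \<open>Only the current cost is nonzero: translation invariance extracts it, and what remains is a
  sequence that vanishes on all histories.  Monotonicity in both directions identifies its risk with
  that of the zero sequence.\<close>
lemma crm_of_current_cost:
  assumes crm: "conditional_risk_measure T t r" and norm: "normalized_crm t r"
    and ti: "translation_invariant_crm T t r"
    and Z: "Z \<in> Zspaces t T" and t: "t \<le> T" and h: "h \<in> space (hist t)"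
    and zero: "\<And>s h. t < s \<Longrightarrow> s \<le> T \<Longrightarrow> h \<in> space (hist s) \<Longrightarrow> Z s h = 0"
  shows "r Z h = Z t h"
proof -
  let ?Z0 = "Z(t := \<lambda>_. 0)"
  have mono: "r V h \<le> r W h"
    if "V \<in> Zspaces t T" "W \<in> Zspaces t T"
      "\<And>s h. s \<in> {t..T} \<Longrightarrow> h \<in> space (hist s) \<Longrightarrow> V s h \<le> W s h" for V W
  proof -
    have "\<forall>V\<in>Zspaces t T. \<forall>W\<in>Zspaces t T.
        (\<forall>s\<in>{t..T}. \<forall>h\<in>space (hist s). V s h \<le> W s h) \<longrightarrow> (\<forall>h\<in>space (hist t). r V h \<le> r W h)"
      using crm by (simp add: conditional_risk_measure_def)
    from bspec[OF bspec[OF this that(1)] that(2)] that(3) h show ?thesis by simp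
  qed
  have mem: "?Z0 \<in> Zspaces t T" "(\<lambda>_ _. 0) \<in> Zspaces t T"
    using Z by (auto simp: Pi_iff)
  have eq: "?Z0 s h = 0" if "s \<in> {t..T}" "h \<in> space (hist s)" for s h
    using zero[of s h] that by auto
  have "r Z h = Z t h + r ?Z0 h"
    using ti Z h unfolding translation_invariant_crm_def by blast
  also have "r ?Z0 h = r (\<lambda>_ _. 0) h"
  proof (rule antisym)
    show "r ?Z0 h \<le> r (\<lambda>_ _. 0) h" by (rule mono[OF mem]) (simp only: eq)
    show "r (\<lambda>_ _. 0) h \<le> r ?Z0 h" by (rule mono[OF mem(2,1)]) (simp only: eq)
  qed
  also have "\<dots> = 0"
    using norm h unfolding normalized_crm_def by blast
  finally show ?thesis by simp
qed

locale risk_averse_control =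
  fixes T :: nat
    and CS :: "'u::polish_space set"
    and U :: "nat \<Rightarrow> 'x::polish_space \<Rightarrow> 'u set"
    and Q :: "nat \<Rightarrow> 'x \<Rightarrow> 'u \<Rightarrow> 'x measure"
    and \<rho> :: "('x, 'u) risk_family"
    and \<sigma> :: "nat \<Rightarrow> 'x \<Rightarrow> 'x measure \<Rightarrow> ('x \<Rightarrow> real) \<Rightarrow> real"
  assumes system: "controlled_markov_system T CS U Q"
    and family: "family_of_dynamic_risk_measures T U \<rho>"
    and normalized: "normalized_family T U \<rho>"
    and translation_invariant: "translation_invariant_family T U \<rho>"
    and transition_risk: "transition_risk_mappings T U Q \<rho> \<sigma>"
begin

lemma U_nonempty: "1 \<le> t \<Longrightarrow> t \<le> T \<Longrightarrow> U t x \<noteq> {}"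
  using system unfolding controlled_markov_system_def by auto

lemma kernel_prob:
  assumes "1 \<le> t" "t < T" "u \<in> U t x"
  shows "sets (Q t x u) = sets borel" "prob_space (Q t x u)"
proof -
  have "(\<lambda>(x, u). Q t x u) \<in> restrict_space borel (graph_of (U t)) \<rightarrow>\<^sub>M prob_algebra borel"
    using system assms unfolding controlled_markov_system_def by auto
  from measurable_space[OF this, of "(x, u)"] assms(3)
  show "sets (Q t x u) = sets borel" "prob_space (Q t x u)"
    by (auto simp: space_restrict_space space_prob_algebra)
qed

lemma policy_value_in_Zspace:
  assumes "\<pi> \<in> policies T U" "c \<in> cost_functions T U" "1 \<le> t" "t \<le> T"
  shows "policy_value \<rho> c \<pi> t \<in> Zspace t"
proof -
  have "\<rho> \<pi> t \<in> Zspaces t T \<rightarrow> Zspace t"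
    using family assms(1,3,4)
    by (simp add: family_of_dynamic_risk_measures_def conditional_risk_measure_def)
  then show ?thesis
    unfolding policy_value_def by (rule funcset_mem) (rule policy_costs_in_Zspaces[OF assms(1-3)])
qed

lemma policy_value_of_current_cost:
  assumes \<pi>: "\<pi> \<in> policies T U" and c: "c \<in> cost_functions T U" and t: "1 \<le> t" "t \<le> T"
    and h: "h \<in> space (hist t)"
    and zero: "\<And>s x u. t < s \<Longrightarrow> s \<le> T \<Longrightarrow> c s x u = 0"
  shows "policy_value \<rho> c \<pi> t h = c t (h t) (\<pi> t h)"
proof -
  have "conditional_risk_measure T t (\<rho> \<pi> t)"
    using family \<pi> t unfolding family_of_dynamic_risk_measures_def by simp
  moreover have "normalized_crm t (\<rho> \<pi> t)"
    using normalized \<pi> t unfolding normalized_family_def by simp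
  moreover have "translation_invariant_crm T t (\<rho> \<pi> t)"
    using translation_invariant \<pi> t unfolding translation_invariant_family_def by simp
  ultimately show ?thesis
    unfolding policy_value_def
    by (rule crm_of_current_cost[OF _ _ _ policy_costs_in_Zspaces[OF \<pi> c t(1)] t(2) h])
      (rule zero)
qed

lemma policy_value_terminal:
  assumes "\<pi> \<in> policies T U" "c \<in> cost_functions T U" "h \<in> space (hist T)"
  shows "policy_value \<rho> c \<pi> T h = c T (h T) (\<pi> T h)"
proof -
  have "1 \<le> T" using system unfolding controlled_markov_system_def by simp
  from policy_value_of_current_cost[OF assms(1,2) this order.refl assms(3)]
  show ?thesis by simp
qed

lemma policy_value_step:
  assumes "\<pi> \<in> policies T U" "c \<in> cost_functions T U" "1 \<le> t" "t < T" "h \<in> space (hist t)"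
  shows "policy_value \<rho> c \<pi> t h = c t (h t) (\<pi> t h) +
    \<sigma> t (h t) (Q t (h t) (\<pi> t h)) (\<lambda>x. policy_value \<rho> c \<pi> (Suc t) (h(Suc t := x)))"
proof -
  have "t \<in> {1..<T}" using assms(3,4) by simp
  note * = bspec[OF transition_risk[unfolded transition_risk_mappings_def] this,
      THEN conjunct2, THEN conjunct2]
  from bspec[OF bspec[OF bspec[OF * assms(1)] assms(2)] assms(5)]
  show ?thesis .
qed

lemma next_value_in_bounded_measurable:
  assumes "\<pi> \<in> policies T U" "c \<in> cost_functions T U" "t < T" "h \<in> space (hist t)"
  shows "(\<lambda>x. policy_value \<rho> c \<pi> (Suc t) (h(Suc t := x))) \<in> bounded_measurable borel"
proof (rule bounded_measurable_compose[OF _ extend_history_measurable[OF assms(4)]])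
  show "policy_value \<rho> c \<pi> (Suc t) \<in> Zspace (Suc t)"
    using assms(3) by (intro policy_value_in_Zspace[OF assms(1,2)]) auto
qed

section \<open>Order and boundedness properties of the transition risk mappings\<close>

lemma transition_risk_dominance:
  assumes "1 \<le> t" "t < T" "u1 \<in> U t x" "u2 \<in> U t x"
    and "v1 \<in> bounded_measurable borel" "v2 \<in> bounded_measurable borel"
    and "\<And>\<eta>::real. measure (Q t x u1) {y. v1 y > \<eta>} \<le> measure (Q t x u2) {y. v2 y > \<eta>}"
  shows "\<sigma> t x (Q t x u1) v1 \<le> \<sigma> t x (Q t x u2) v2"
proof -
  have "t \<in> {1..<T}" using assms(1,2) by simp
  note * = bspec[OF transition_risk[unfolded transition_risk_mappings_def] this,
      THEN conjunct2, THEN conjunct1]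
  have "\<forall>\<eta>::real. measure (Q t x u1) {y. v1 y > \<eta>} \<le> measure (Q t x u2) {y. v2 y > \<eta>}"
    using assms(7) ..
  from bspec[OF bspec[OF bspec[OF bspec[OF spec[OF *] imageI[OF assms(3)]] imageI[OF assms(4)]]
      assms(5)] assms(6), THEN mp, OF this]
  show ?thesis .
qed

lemma transition_risk_mono:
  assumes t: "1 \<le> t" "t < T" and u: "u \<in> U t x"
    and v: "v1 \<in> bounded_measurable borel" "v2 \<in> bounded_measurable borel"
    and le: "\<And>y. v1 y \<le> v2 y"
  shows "\<sigma> t x (Q t x u) v1 \<le> \<sigma> t x (Q t x u) v2"
proof (rule transition_risk_dominance[OF t u u v])
  fix \<eta> :: real
  interpret prob_space "Q t x u" using kernel_prob(2)[OF t u] .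
  have [measurable]: "v2 \<in> borel_measurable borel"
    using v(2) by (simp add: bounded_measurable_def)
  show "measure (Q t x u) {y. v1 y > \<eta>} \<le> measure (Q t x u) {y. v2 y > \<eta>}"
  proof (rule finite_measure_mono)
    show "{y. v1 y > \<eta>} \<subseteq> {y. v2 y > \<eta>}"
      using le by (auto intro: less_le_trans)
    have "{y \<in> space borel. v2 y > \<eta>} \<in> sets borel"
      by measurable
    then show "{y. v2 y > \<eta>} \<in> sets (Q t x u)"
      using kernel_prob(1)[OF t u] by simp
  qed
qed

text \<open>A constant has the same tail probabilities under every probability measure.\<close>
lemma transition_risk_const_cong:
  assumes t: "1 \<le> t" "t < T" and u: "u1 \<in> U t x" "u2 \<in> U t x"
  shows "\<sigma> t x (Q t x u1) (\<lambda>_. a) = \<sigma> t x (Q t x u2) (\<lambda>_. a)"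
proof -
  have "measure (Q t x u) UNIV = 1" if "u \<in> U t x" for u
  proof -
    interpret prob_space "Q t x u" using kernel_prob(2)[OF t that] .
    show ?thesis
      using prob_space sets_eq_imp_space_eq[OF kernel_prob(1)[OF t that]] by simp
  qed
  then have "measure (Q t x u1) {y. a > \<eta>} = measure (Q t x u2) {y. a > \<eta>}" for \<eta>
    using u by (cases "a > \<eta>") auto
  then show ?thesis
    using transition_risk_dominance[OF t u(1,2), of "\<lambda>_. a" "\<lambda>_. a"]
      transition_risk_dominance[OF t u(2,1), of "\<lambda>_. a" "\<lambda>_. a"] by simp
qed

text \<open>Translation invariance does not make \<open>\<sigma>\<close> of a constant equal to that constant, so the bound
  is obtained by realizing the expression as a conditional risk: charge the cost \<open>a\<close> at time
  \<open>Suc t\<close> and nothing else.  The value at time \<open>t\<close> of a fixed policy \<open>\<pi>\<close> is a bounded function of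
  the history, and it controls all \<open>u\<close> since the choice of the control does not matter for constants.\<close>
lemma transition_risk_bounded_const:
  assumes \<pi>: "\<pi> \<in> policies T U" and t: "1 \<le> t" "t < T"
  shows "\<exists>B. \<forall>x. \<forall>u\<in>U t x. \<bar>\<sigma> t x (Q t x u) (\<lambda>_. a)\<bar> \<le> B"
proof -
  define c :: "nat \<Rightarrow> 'x \<Rightarrow> 'u \<Rightarrow> real" where "c s x u = (if s = Suc t then a else 0)" for s x u
  have c: "c \<in> cost_functions T U"
  proof -
    have "(\<lambda>(x, u). c s x u) = (\<lambda>_. if s = Suc t then a else 0)" for s
      by (auto simp: c_def fun_eq_iff)
    then show ?thesis by (simp add: cost_functions_def)
  qed
  obtain B where B: "\<forall>h\<in>space (hist t). \<bar>policy_value \<rho> c \<pi> t h\<bar> \<le> B"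
    using policy_value_in_Zspace[OF \<pi> c t(1)] t(2) by (auto simp: bounded_measurable_iff)
  have "\<bar>\<sigma> t x (Q t x u) (\<lambda>_. a)\<bar> \<le> B" if u: "u \<in> U t x" for x u
  proof -
    obtain h where h: "h \<in> space (hist t)" "h t = x"
      using history_with_last_component[OF t(1)] by blast
    have "policy_value \<rho> c \<pi> (Suc t) h' = a" if "h' \<in> space (hist (Suc t))" for h'
      using policy_value_of_current_cost[OF \<pi> c _ _ that] t by (simp add: c_def)
    then have "policy_value \<rho> c \<pi> (Suc t) (h(Suc t := y)) = a" for y
      using extend_history_in_space[OF h(1)] by blast
    then have "policy_value \<rho> c \<pi> t h = \<sigma> t x (Q t x (\<pi> t h)) (\<lambda>_. a)"
      using policy_value_step[OF \<pi> c t h(1)] by (simp add: c_def h(2))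
    also have "\<dots> = \<sigma> t x (Q t x u) (\<lambda>_. a)"
    proof (rule transition_risk_const_cong[OF t _ u])
      show "\<pi> t h \<in> U t x"
        using policiesD(2)[OF \<pi> t(1) less_imp_le[OF t(2)] h(1)] by (simp only: h(2))
    qed
    finally show ?thesis
      using bspec[OF B h(1)] by simp
  qed
  then show ?thesis by blast
qed

lemma transition_risk_bounded:
  assumes \<pi>: "\<pi> \<in> policies T U" and t: "1 \<le> t" "t < T" and v: "v \<in> bounded_measurable borel"
  shows "\<exists>B. \<forall>x. \<forall>u\<in>U t x. \<bar>\<sigma> t x (Q t x u) v\<bar> \<le> B"
proof -
  obtain b where b: "\<forall>y. \<bar>v y\<bar> \<le> b"
    using v by (auto simp: bounded_measurable_iff)
  obtain B1 where B1: "\<forall>x. \<forall>u\<in>U t x. \<bar>\<sigma> t x (Q t x u) (\<lambda>_. - b)\<bar> \<le> B1"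
    using transition_risk_bounded_const[OF \<pi> t] by blast
  obtain B2 where B2: "\<forall>x. \<forall>u\<in>U t x. \<bar>\<sigma> t x (Q t x u) (\<lambda>_. b)\<bar> \<le> B2"
    using transition_risk_bounded_const[OF \<pi> t] by blast
  have "\<bar>\<sigma> t x (Q t x u) v\<bar> \<le> max B1 B2" if u: "u \<in> U t x" for x u
  proof -
    have vb: "- b \<le> v y" "v y \<le> b" for y
      using b[rule_format, of y] by linarith+
    have "\<sigma> t x (Q t x u) (\<lambda>_. - b) \<le> \<sigma> t x (Q t x u) v"
      by (rule transition_risk_mono[OF t u const_in_bounded_measurable v vb(1)])
    moreover have "\<sigma> t x (Q t x u) v \<le> \<sigma> t x (Q t x u) (\<lambda>_. b)"
      by (rule transition_risk_mono[OF t u v const_in_bounded_measurable vb(2)])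
    ultimately show ?thesis
      using B1[rule_format, OF u] B2[rule_format, OF u] by linarith
  qed
  then show ?thesis by blast
qed

section \<open>Verification\<close>

text \<open>The assumptions say that \<open>w\<close> is a subsolution of the dynamic programming equations.  In
  the induction, monotonicity of the transition risk mapping replaces the next value of the policy by
  the smaller \<open>w\<close>, and the inequality for \<open>w\<close> at the control \<open>\<pi> s h\<close> does the rest.\<close>
lemma policy_value_lower_bound:
  assumes \<pi>: "\<pi> \<in> policies T U" and c: "c \<in> cost_functions T U" and t: "1 \<le> t" "t \<le> T"
    and w: "\<And>s. 1 \<le> s \<Longrightarrow> s \<le> T \<Longrightarrow> w s \<in> bounded_measurable borel"
    and terminal: "\<And>x u. u \<in> U T x \<Longrightarrow> w T x \<le> c T x u"
    and step: "\<And>s x u. 1 \<le> s \<Longrightarrow> s < T \<Longrightarrow> u \<in> U s x \<Longrightarrow>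
      w s x \<le> c s x u + \<sigma> s x (Q s x u) (w (Suc s))"
    and h: "h \<in> space (hist t)"
  shows "w t (h t) \<le> policy_value \<rho> c \<pi> t h"
  using t(2) h
proof (induction arbitrary: h rule: inc_induct)
  case base
  then show ?case
    using policy_value_terminal[OF \<pi> c] policiesD(2)[OF \<pi>, of T] t terminal by simp
next
  case (step s)
  then have s: "1 \<le> s" "s < T" using t by auto
  have u: "\<pi> s h \<in> U s (h s)"
    using policiesD(2)[OF \<pi>] s step.prems by simp
  have "w (Suc s) x \<le> policy_value \<rho> c \<pi> (Suc s) (h(Suc s := x))" for x
    using step.IH[OF extend_history_in_space[OF step.prems], of x] by (simp only: fun_upd_same)
  then have "\<sigma> s (h s) (Q s (h s) (\<pi> s h)) (w (Suc s)) \<le>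
    \<sigma> s (h s) (Q s (h s) (\<pi> s h)) (\<lambda>x. policy_value \<rho> c \<pi> (Suc s) (h(Suc s := x)))"
    using w[of "Suc s"] s
    by (intro transition_risk_mono[OF s u _ next_value_in_bounded_measurable[OF \<pi> c s(2) step.prems]])
       auto
  then show ?case
    using policy_value_step[OF \<pi> c s step.prems] assms(7)[OF s u] by linarith
qed

lemma policy_value_of_selector:
  assumes \<pi>: "(\<lambda>t h. \<phi> t (h t)) \<in> policies T U" and c: "c \<in> cost_functions T U"
    and t: "1 \<le> t" "t \<le> T"
    and terminal: "\<And>x. w T x = c T x (\<phi> T x)"
    and step: "\<And>s x. 1 \<le> s \<Longrightarrow> s < T \<Longrightarrow>
      w s x = c s x (\<phi> s x) + \<sigma> s x (Q s x (\<phi> s x)) (w (Suc s))"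
    and h: "h \<in> space (hist t)"
  shows "policy_value \<rho> c (\<lambda>t h. \<phi> t (h t)) t h = w t (h t)"
  using t(2) h
proof (induction arbitrary: h rule: inc_induct)
  case base
  then show ?case
    using policy_value_terminal[OF \<pi> c] terminal by simp
next
  case (step s)
  then have s: "1 \<le> s" "s < T" using t by auto
  have "policy_value \<rho> c (\<lambda>t h. \<phi> t (h t)) (Suc s) (h(Suc s := x)) = w (Suc s) x" for x
    using step.IH[OF extend_history_in_space[OF step.prems], of x] by (simp only: fun_upd_same)
  then show ?case
    using policy_value_step[OF \<pi> c s step.prems] assms(6)[OF s] by simp
qed

end

section \<open>Dynamic programming equations\<close>

text \<open>The solution of the dynamic programming equations, by recursion on the number \<open>T - t\<close> of
  remaining steps.  The infimum stands for the minimum, whose existence is proved along with the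
  regularity of the function.\<close>
function dp_value :: "nat \<Rightarrow> (nat \<Rightarrow> 'x \<Rightarrow> 'u set) \<Rightarrow> (nat \<Rightarrow> 'x \<Rightarrow> 'u \<Rightarrow> 'x measure)
    \<Rightarrow> (nat \<Rightarrow> 'x \<Rightarrow> 'u \<Rightarrow> real) \<Rightarrow> (nat \<Rightarrow> 'x \<Rightarrow> 'x measure \<Rightarrow> ('x \<Rightarrow> real) \<Rightarrow> real)
    \<Rightarrow> nat \<Rightarrow> 'x \<Rightarrow> real" where
  "dp_value T U Q c \<sigma> t =
    (if t < T
     then (\<lambda>x. INF u\<in>U t x. c t x u + \<sigma> t x (Q t x u) (dp_value T U Q c \<sigma> (Suc t)))
     else (\<lambda>x. INF u\<in>U t x. c t x u))"
  by pat_completeness auto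
termination
  by (relation "Wellfounded.measure (\<lambda>(T, U, Q, c, \<sigma>, t). T - t)") auto

declare dp_value.simps [simp del]

lemma INF_eq_arg_min:
  fixes f :: "'u \<Rightarrow> real"
  assumes "is_arg_min f (\<lambda>u. u \<in> S) u"
  shows "(INF u\<in>S. f u) = f u"
  using assms by (intro cInf_eq_minimum) (auto simp: is_arg_min_linorder)

text \<open>This is where weak continuity of the kernels meets the joint lower semicontinuity of the
  transition risk mappings in the state and the measure.\<close>
lemma lsc_map_one_step_cost:
  fixes F :: "'x::polish_space \<Rightarrow> 'u::polish_space set"
  assumes kernel: "continuous_map (subtopology euclidean (graph_of F)) weak_topology (\<lambda>(x, u). q x u)"
    and risk: "lsc_map (subtopology (prod_topology euclidean weak_topology)
      {(x, q x u) | x u. u \<in> F x}) (\<lambda>(x, p). r x p)"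
    and cost: "lsc_map (subtopology euclidean (graph_of F)) (\<lambda>(x, u). g x u)"
  shows "lsc_map (subtopology euclidean (graph_of F)) (\<lambda>(x, u). g x u + r x (q x u))"
proof -
  let ?X = "subtopology euclidean (graph_of F)"
  have "continuous_map ?X euclidean fst"
    by (simp add: continuous_on_fst continuous_on_id)
  then have "continuous_map ?X (prod_topology euclidean weak_topology)
      (\<lambda>z. (fst z, (\<lambda>(x, u). q x u) z))"
    using kernel by (rule continuous_map_pairedI)
  then have "continuous_map ?X (subtopology (prod_topology euclidean weak_topology)
      {(x, q x u) | x u. u \<in> F x}) (\<lambda>z. (fst z, (\<lambda>(x, u). q x u) z))"
    by (rule continuous_map_into_subtopology) auto
  from lsc_map_add[OF cost lsc_map_compose[OF this risk]]
  show ?thesis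
    by (simp add: case_prod_unfold)
qed

lemma lsc_map_const: "lsc_map X (\<lambda>_. a)"
  unfolding lsc_map_def
proof
  fix b show "openin X {x \<in> topspace X. b < a}"
    by (cases "b < a") auto
qed

theorem theorem4p5:
  fixes T :: nat
    and CS :: "'u::polish_space set"
    and U :: "nat \<Rightarrow> 'x::polish_space \<Rightarrow> 'u set"
    and Q :: "nat \<Rightarrow> 'x \<Rightarrow> 'u \<Rightarrow> 'x measure"
    and c :: "nat \<Rightarrow> 'x \<Rightarrow> 'u \<Rightarrow> real"
    and \<rho> :: "('x, 'u) risk_family"
    and \<sigma> :: "nat \<Rightarrow> 'x \<Rightarrow> 'x measure \<Rightarrow> ('x \<Rightarrow> real) \<Rightarrow> real"
  assumes system: "controlled_markov_system T CS U Q"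
    and costs: "c \<in> cost_functions T U"
    and family: "family_of_dynamic_risk_measures T U \<rho>"
    and normalized: "normalized_family T U \<rho>"
    and translation_invariant: "translation_invariant_family T U \<rho>"
    and time_consistent: "stochastically_conditionally_time_consistent T U Q \<rho>"
    and markov: "markov_family T U \<rho>"
    and transition_risk: "transition_risk_mappings T U Q \<rho> \<sigma>"
    and Q_cont: "\<And>t. t \<in> {1..<T} \<Longrightarrow>
      continuous_map (subtopology euclidean (graph_of (U t))) weak_topology (\<lambda>(x, u). Q t x u)"
    and \<sigma>_lsc: "\<And>t v. t \<in> {1..<T} \<Longrightarrow> v \<in> bounded_measurable borel \<Longrightarrow> lsc_map euclidean v \<Longrightarrow>
      lsc_map (subtopology (prod_topology euclidean weak_topology)
                 {(x, Q t x u) | x u. u \<in> U t x})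
        (\<lambda>(x, q). \<sigma> t x q v)"
    and c_lsc: "\<And>t. t \<in> {1..T} \<Longrightarrow>
      lsc_map (subtopology euclidean (graph_of (U t))) (\<lambda>(x, u). c t x u)"
    and U_compact: "\<And>t x. t \<in> {1..T} \<Longrightarrow> compact (U t x)"
    and U_usc: "\<And>t. t \<in> {1..T} \<Longrightarrow> usc_multifunction (U t)"
  shows "\<exists>w :: nat \<Rightarrow> 'x \<Rightarrow> real.
    (\<forall>t\<in>{1..T}. \<forall>h\<in>space (hist t). value_function T U \<rho> c t h = w t (h t)) \<and>
    (\<forall>t\<in>{1..T}. w t \<in> bounded_measurable borel \<and> lsc_map euclidean (w t)) \<and>
    (\<forall>x. is_minimum_on (c T x) (U T x) (w T x)) \<and>
    (\<forall>t\<in>{1..<T}. \<forall>x.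
       is_minimum_on (\<lambda>u. c t x u + \<sigma> t x (Q t x u) (w (Suc t))) (U t x) (w t x)) \<and>
    (\<exists>\<phi> :: nat \<Rightarrow> 'x \<Rightarrow> 'u.
       (\<lambda>t h. \<phi> t (h t)) \<in> markov_policies T U \<and>
       optimal_policy T U \<rho> c (\<lambda>t h. \<phi> t (h t)) \<and>
       (\<forall>x. is_arg_min (c T x) (\<lambda>u. u \<in> U T x) (\<phi> T x)) \<and>
       (\<forall>t\<in>{1..<T}. \<forall>x.
          is_arg_min (\<lambda>u. c t x u + \<sigma> t x (Q t x u) (w (Suc t))) (\<lambda>u. u \<in> U t x) (\<phi> t x)))"
proof -
  interpret risk_averse_control T CS U Q \<rho> \<sigma>
    by (rule risk_averse_control.intro[OF system family normalized translation_invariant transition_risk])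
  have T: "1 \<le> T"
    using system by (simp add: controlled_markov_system_def)
  have selection: "\<exists>\<phi>\<in>borel_measurable borel.
      (\<forall>x. is_arg_min (f x) (\<lambda>u. u \<in> U t x) (\<phi> x)) \<and> lsc_map euclidean (\<lambda>x. f x (\<phi> x))"
    if "lsc_map (subtopology euclidean (graph_of (U t))) (\<lambda>(x, u). f x u)" "t \<in> {1..T}" for f t
    using argmin_selection[OF U_usc[OF that(2)] U_compact[OF that(2)] _ that(1)] U_nonempty that(2)
    by auto

  \<comment> \<open>An arbitrary admissible policy, needed for the uniform bound on the transition risk mappings;
    it minimizes the zero function.\<close>
  have "\<forall>t\<in>{1..T}. \<exists>\<phi>. \<phi> \<in> borel_measurable borel \<and> (\<forall>x. \<phi> x \<in> U t x)"
  proof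
    fix t assume t: "t \<in> {1..T}"
    have "lsc_map (subtopology euclidean (graph_of (U t))) (\<lambda>(x, u). 0)"
      using lsc_map_const[of _ 0] by (simp add: case_prod_unfold)
    from selection[OF this t] show "\<exists>\<phi>. \<phi> \<in> borel_measurable borel \<and> (\<forall>x. \<phi> x \<in> U t x)"
      unfolding is_arg_min_def by blast
  qed
  then obtain \<phi>0 where \<phi>0: "\<forall>t\<in>{1..T}. \<phi>0 t \<in> borel_measurable borel \<and> (\<forall>x. \<phi>0 t x \<in> U t x)"
    unfolding bchoice_iff by blast
  then have "(\<lambda>t h. \<phi>0 t (h t)) \<in> markov_policies T U"
    by (intro markov_policyI) auto
  then have \<pi>0: "(\<lambda>t h. \<phi>0 t (h t)) \<in> policies T U"
    by (simp add: markov_policies_def)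

  \<comment> \<open>\<open>J t x u\<close> is the objective of the dynamic programming equation at time \<open>t\<close>.\<close>
  define w where "w = dp_value T U Q c \<sigma>"
  define J where "J t x u = (if t < T then c t x u + \<sigma> t x (Q t x u) (w (Suc t)) else c t x u)" for t x u
  have w_eq: "w t x = (INF u\<in>U t x. J t x u)" for t x
    unfolding w_def J_def by (subst dp_value.simps) simp

  have dp_step: "w t \<in> bounded_measurable borel \<and> lsc_map euclidean (w t) \<and>
      (\<exists>\<phi>\<in>borel_measurable borel. \<forall>x. is_arg_min (J t x) (\<lambda>u. u \<in> U t x) (\<phi> x))"
    if t: "t \<in> {1..T}"
      and nxt: "t < T \<Longrightarrow> w (Suc t) \<in> bounded_measurable borel \<and> lsc_map euclidean (w (Suc t))"
    for t
  proof -
    have J_lsc: "lsc_map (subtopology euclidean (graph_of (U t))) (\<lambda>(x, u). J t x u)"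
    proof (cases "t < T")
      case True
      then have t': "t \<in> {1..<T}" using t by simp
      from lsc_map_one_step_cost[OF Q_cont[OF t'] \<sigma>_lsc[OF t'] c_lsc[OF t]] nxt[OF True] True
      show ?thesis by (simp add: J_def)
    qed (use c_lsc[OF t] in \<open>simp add: J_def\<close>)
    obtain \<phi> where \<phi>: "\<phi> \<in> borel_measurable borel"
      "\<forall>x. is_arg_min (J t x) (\<lambda>u. u \<in> U t x) (\<phi> x)" "lsc_map euclidean (\<lambda>x. J t x (\<phi> x))"
      using selection[OF J_lsc t] by blast
    have w_\<phi>: "w t x = J t x (\<phi> x)" for x
      unfolding w_eq using \<phi>(2) by (intro INF_eq_arg_min) blast
    then have lsc: "lsc_map euclidean (w t)"
      using \<phi>(3) by (simp add: w_\<phi>[abs_def])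
    have \<phi>_adm: "\<phi> x \<in> U t x" for x
      using \<phi>(2) unfolding is_arg_min_def by blast
    have "(\<lambda>(x, u). c t x u) \<in> bounded_measurable (restrict_space borel (graph_of (U t)))"
      using costs t by (simp add: cost_functions_def)
    then obtain B1 where B1: "\<forall>x. \<forall>u\<in>U t x. \<bar>c t x u\<bar> \<le> B1"
      by (auto simp: bounded_measurable_iff space_restrict_space)
    obtain B2 where B2: "t < T \<Longrightarrow> \<forall>x. \<forall>u\<in>U t x. \<bar>\<sigma> t x (Q t x u) (w (Suc t))\<bar> \<le> B2"
      using transition_risk_bounded[OF \<pi>0, of t "w (Suc t)"] nxt t by (cases "t < T") auto
    have "\<bar>w t x\<bar> \<le> B1 + \<bar>B2\<bar>" for x
    proof (cases "t < T")
      case True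
      from B1[rule_format, OF \<phi>_adm, of x] B2[OF True, rule_format, OF \<phi>_adm, of x] True
      show ?thesis unfolding w_\<phi> J_def by simp
    next
      case False
      with B1[rule_format, OF \<phi>_adm, of x] show ?thesis unfolding w_\<phi> J_def by simp
    qed
    then have "w t \<in> bounded_measurable borel"
      using borel_measurable_lsc_map[OF lsc] by (auto simp: bounded_measurable_iff)
    with lsc \<phi>(1,2) show ?thesis by blast
  qed

  have dp: "w t \<in> bounded_measurable borel \<and> lsc_map euclidean (w t) \<and>
      (\<exists>\<phi>\<in>borel_measurable borel. \<forall>x. is_arg_min (J t x) (\<lambda>u. u \<in> U t x) (\<phi> x))"
    if "1 \<le> t" "t \<le> T" for t
    using that(2,1)
  proof (induction rule: inc_induct)
    case base
    then show ?case using T by (intro dp_step) auto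
  next
    case (step s)
    then show ?case by (intro dp_step) auto
  qed
  then have "\<forall>t\<in>{1..T}. \<exists>\<phi>. \<phi> \<in> borel_measurable borel \<and>
      (\<forall>x. is_arg_min (J t x) (\<lambda>u. u \<in> U t x) (\<phi> x))"
    by (meson atLeastAtMost_iff)
  then obtain \<phi> where \<phi>: "\<forall>t\<in>{1..T}. \<phi> t \<in> borel_measurable borel \<and>
      (\<forall>x. is_arg_min (J t x) (\<lambda>u. u \<in> U t x) (\<phi> t x))"
    unfolding bchoice_iff by blast
  then have \<phi>_min: "is_arg_min (J t x) (\<lambda>u. u \<in> U t x) (\<phi> t x)" if "t \<in> {1..T}" for t x
    using that by blast
  have \<phi>_adm: "\<phi> t x \<in> U t x" if "t \<in> {1..T}" for t x
    using \<phi>_min[OF that] by (simp add: is_arg_min_def)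
  have w_\<phi>: "w t x = J t x (\<phi> t x)" if "t \<in> {1..T}" for t x
    unfolding w_eq by (rule INF_eq_arg_min[OF \<phi>_min[OF that]])
  have w_le: "w t x \<le> J t x u" if "t \<in> {1..T}" "u \<in> U t x" for t x u
    using \<phi>_min[OF that(1), of x] that unfolding w_\<phi>[OF that(1)] is_arg_min_linorder by blast
  have w_minimum: "is_minimum_on (J t x) (U t x) (w t x)" if "t \<in> {1..T}" for t x
    unfolding is_minimum_on_def using \<phi>_adm[OF that] w_\<phi>[OF that, of x] w_le[OF that] by metis

  \<comment> \<open>Verification: the selected minimizers attain \<open>w\<close>, and no policy does better.\<close>
  let ?\<pi> = "\<lambda>t h. \<phi> t (h t)"
  have markov_\<phi>: "?\<pi> \<in> markov_policies T U"
    using \<phi> \<phi>_adm by (intro markov_policyI) auto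
  then have policy_\<phi>: "?\<pi> \<in> policies T U"
    by (simp add: markov_policies_def)
  have value_\<phi>: "policy_value \<rho> c ?\<pi> t h = w t (h t)" if t: "t \<in> {1..T}" and h: "h \<in> space (hist t)" for t h
  proof (rule policy_value_of_selector[OF policy_\<phi> costs _ _ _ _ h])
    show "w T x = c T x (\<phi> T x)" for x
      using w_\<phi>[of T x] T by (simp add: J_def)
    show "w s x = c s x (\<phi> s x) + \<sigma> s x (Q s x (\<phi> s x)) (w (Suc s))" if "1 \<le> s" "s < T" for s x
      using w_\<phi>[of s x] that by (simp add: J_def)
  qed (use t in auto)
  have lower: "w t (h t) \<le> policy_value \<rho> c \<pi> t h"
    if \<pi>: "\<pi> \<in> policies T U" and t: "t \<in> {1..T}" and h: "h \<in> space (hist t)" for \<pi> t h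
  proof (rule policy_value_lower_bound[OF \<pi> costs _ _ _ _ _ h])
    show "w s \<in> bounded_measurable borel" if "1 \<le> s" "s \<le> T" for s
      using dp[OF that] by blast
    show "w T x \<le> c T x u" if "u \<in> U T x" for x u
      using w_le[of T u x] that T by (simp add: J_def)
    show "w s x \<le> c s x u + \<sigma> s x (Q s x u) (w (Suc s))" if "1 \<le> s" "s < T" "u \<in> U s x" for s x u
      using w_le[of s u x] that by (simp add: J_def)
  qed (use t in auto)
  have value_w: "value_function T U \<rho> c t h = w t (h t)" if "t \<in> {1..T}" "h \<in> space (hist t)" for t h
    unfolding value_function_def
  proof (rule cInf_eq_minimum)
    show "w t (h t) \<in> (\<lambda>\<pi>. policy_value \<rho> c \<pi> t h) ` policies T U"
      using imageI[OF policy_\<phi>, of "\<lambda>\<pi>. policy_value \<rho> c \<pi> t h"]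
      by (simp only: value_\<phi>[OF that])
  qed (use lower[OF _ that] in blast)
  have optimal: "optimal_policy T U \<rho> c ?\<pi>"
    unfolding optimal_policy_def using policy_\<phi> value_\<phi>[of 1] value_w[of 1] T by simp
  have J_T: "J T x = c T x" for x
    by (simp add: J_def fun_eq_iff)
  have J_less: "J t x = (\<lambda>u. c t x u + \<sigma> t x (Q t x u) (w (Suc t)))" if "t < T" for t x
    using that by (simp add: J_def fun_eq_iff)
  show ?thesis
  proof (rule exI[of _ w], intro conjI exI[of _ \<phi>] ballI allI)
    show "is_minimum_on (c T x) (U T x) (w T x)" for x
      using w_minimum[of T x] T by (simp add: J_T)
    show "is_arg_min (c T x) (\<lambda>u. u \<in> U T x) (\<phi> T x)" for x
      using \<phi>_min[of T x] T by (simp add: J_T)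
    fix t x assume t: "t \<in> {1..<T}"
    show "is_minimum_on (\<lambda>u. c t x u + \<sigma> t x (Q t x u) (w (Suc t))) (U t x) (w t x)"
      using w_minimum[of t x] t by (simp add: J_less)
    show "is_arg_min (\<lambda>u. c t x u + \<sigma> t x (Q t x u) (w (Suc t))) (\<lambda>u. u \<in> U t x) (\<phi> t x)"
      using \<phi>_min[of t x] t by (simp add: J_less)
  qed (use value_w dp markov_\<phi> optimal in auto)
qed

end
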